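(* For all $n\ge1$, $$D_n^{\mathsf{cddes}}(-1)=\begin{cases}E_n,&\text{if } n\text{ is even},\\ 0,&\text{if } n\text{ is odd}.\end{cases}$$ Thus $D^{\mathsf{cddes}}(-1;x)=\sec(x)$ (as formal power series in $x$).
   Context: Let $\mathfrak{D}_n$ be the set of derangements of $[n]=\{1,\dots,n\}$, i.e. permutations $\pi=\pi_1\cdots\pi_n$ (one-line notation, $\pi_i=\pi(i)$) with $\pi_i\ne i$ for all $i$. For a permutation $\pi$ of $[n]$, the letter $\pi_i$ is a cyclic double descent if $i>\pi_i>\pi_{\pi_i}$; let $\mathsf{cddes}(\pi)$ be the number of cyclic double descents of $\pi$. Define $D_n^{\mathsf{cddes}}(t)=\sum_{\pi\in\mathfrak{D}_n}t^{\mathsf{cddes}(\pi)}$ and $D^{\mathsf{cddes}}(t;x)=1+\sum_{n=1}^\infty D_n^{\mathsf{cddes}}(t)\frac{x^n}{n!}$. The Euler numbers $E_n$ are defined by $\sum_{n=0}^\infty E_n\frac{x^n}{n!}=\sec(x)+\tan(x)$. *)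

theory Defs
  imports
    Complex_Main
    "HOL-Combinatorics.Permutations"
    "HOL-Computational_Algebra.Formal_Power_Series"
begin

definition derangements :: "nat \<Rightarrow> (nat \<Rightarrow> nat) set" where
  "derangements n = {\<pi>. \<pi> permutes {1..n} \<and> (\<forall>i\<in>{1..n}. \<pi> i \<noteq> i)}"

definition cddes :: "nat \<Rightarrow> (nat \<Rightarrow> nat) \<Rightarrow> nat" where
  "cddes n \<pi> = card {i \<in> {1..n}. i > \<pi> i \<and> \<pi> i > \<pi> (\<pi> i)}"

definition D_cddes :: "nat \<Rightarrow> real \<Rightarrow> real" where
  "D_cddes n t = (\<Sum>\<pi>\<in>derangements n. t ^ cddes n \<pi>)"

definition D_cddes_egf :: "real \<Rightarrow> real fps" where
  "D_cddes_egf t = 1 + Abs_fps (\<lambda>n. if n = 0 then 0 else D_cddes n t / fact n)"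

definition fps_sec :: "'a::field_char_0 \<Rightarrow> 'a fps" where
  "fps_sec c = 1 / fps_cos c"

definition euler_number :: "nat \<Rightarrow> real" where
  "euler_number n = fact n * fps_nth (fps_sec 1 + fps_tan 1) n"

lemma euler_number_egf: "Abs_fps (\<lambda>n. euler_number n / fact n) = fps_sec 1 + fps_tan 1"
  by (simp add: fps_eq_iff euler_number_def)

end

theory Submission
  imports Defs
begin

unbundle fps_syntax

text \<open>
  Give each letter of a permutation a power series weight according to its cyclic type:
  fixed points \<open>tan\<close>, double ascents \<open>tan + 1\<close>, double descents \<open>tan - 1\<close>, valleys \<open>1\<close>,
  peaks \<open>sec\<^sup>2\<close>. Inserting a new maximum \<open>m\<close> into an arc \<open>a \<rightarrow> b\<close> of a cycle creates a peak and
  changes the type of just one other letter, namely \<open>max a b\<close>. Summed over all arcs,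
  these changes act on the product of the weights exactly as differentiation does, because
  \<open>tan' = sec\<^sup>2\<close> and \<open>(sec\<^sup>2)' = ((tan + 1) + (tan - 1)) * sec\<^sup>2\<close>; the new fixed point \<open>m\<close>
  contributes the factor \<open>tan\<close>, which is the logarithmic derivative of \<open>sec\<close>. Hence the
  \<open>n\<close>-th derivative of \<open>sec\<close> is \<open>sec\<close> times the total weight of the permutations of \<open>n\<close>
  letters. At \<open>0\<close> the weights are \<open>0, 1, -1, 1, 1\<close>, so the total weight becomes the signed
  count of derangements.
\<close>

section \<open>Power series: secant and tangent\<close>

lemma fps_deriv_prod:
  fixes f :: "'b \<Rightarrow> 'a::comm_ring_1 fps"
  assumes "finite A"
  shows "fps_deriv (prod f A) = (\<Sum>i\<in>A. fps_deriv (f i) * prod f (A - {i}))"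
  using assms
proof (induction A rule: finite_induct)
  case (insert a A)
  have "prod f (insert a A - {i}) = f a * prod f (A - {i})" if "i \<in> A" for i
  proof -
    have "insert a A - {i} = insert a (A - {i})"
      using that insert.hyps by auto
    then show ?thesis
      using insert.hyps by simp
  qed
  then have "(\<Sum>i\<in>A. fps_deriv (f i) * prod f (insert a A - {i})) = f a * fps_deriv (prod f A)"
    unfolding insert.IH sum_distrib_left by (intro sum.cong) (simp_all add: mult_ac)
  then show ?case
    using insert.hyps by (simp add: algebra_simps)
qed simp

text \<open>In the convolution for \<open>(A * B) $ n\<close>, odd-indexed terms vanish since
  \<open>A\<close> is even, and terms of even index i > 0 vanish by induction, since n - i has the
  parity of n. Only \<open>A $ 0 * B $ n\<close> is left. This is applied to cos * sec = 1 and cos *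
  tan = sin.\<close>

lemma fps_parity_of_even_factor:
  fixes A B :: "'a::idom fps"
  assumes A0: "A $ 0 \<noteq> 0" and A: "\<And>n. odd n \<Longrightarrow> A $ n = 0"
    and AB: "\<And>n. even n = e \<Longrightarrow> (A * B) $ n = 0"
  shows "even n = e \<Longrightarrow> B $ n = 0"
proof (induction n rule: less_induct)
  case (less n)
  have "A $ i * B $ (n - i) = 0" if "i \<in> {0..n} - {0}" for i
  proof (cases "even i")
    case True
    then have "even (n - i) = e"
      using that less.prems by auto
    then show ?thesis
      using that less.IH[of "n - i"] by auto
  qed (simp add: A)
  then have "(\<Sum>i\<in>{0..n} - {0}. A $ i * B $ (n - i)) = 0"
    by (intro sum.neutral) blast
  then have "(A * B) $ n = A $ 0 * B $ n"
    by (simp add: fps_mult_nth sum.remove[of "{0..n}" 0])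
  then show ?case
    using AB[OF less.prems] A0 by simp
qed

lemma fps_cos_mult_sec: "fps_cos 1 * fps_sec 1 = (1 :: 'a::field_char_0 fps)"
  by (simp add: fps_sec_def fps_divide_unit inverse_mult_eq_1')

lemma fps_tan_eq_sin_mult_sec: "fps_tan 1 = fps_sin 1 * (fps_sec 1 :: 'a::field_char_0 fps)"
  by (simp add: fps_sec_def fps_tan_def fps_divide_unit)

lemma fps_deriv_sec: "fps_deriv (fps_sec 1) = fps_sec 1 * (fps_tan 1 :: 'a::field_char_0 fps)"
proof -
  have "fps_sec 1 = inverse (fps_cos 1 :: 'a fps)"
    by (simp add: fps_sec_def fps_divide_unit)
  then show ?thesis
    by (simp add: fps_inverse_deriv fps_cos_deriv fps_tan_eq_sin_mult_sec
        power2_eq_square mult_ac flip: fps_const_neg)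
qed

lemma fps_deriv_tan: "fps_deriv (fps_tan 1) = (fps_sec 1 :: 'a::field_char_0 fps)\<^sup>2"
proof -
  have "fps_deriv (fps_tan 1) =
      fps_sec 1 * (fps_cos 1 + fps_sin 1 * (fps_sin 1 * (fps_sec 1 :: 'a fps)))"
    by (simp add: fps_tan_eq_sin_mult_sec fps_deriv_sec fps_sin_deriv algebra_simps)
  \<comment> \<open>Writing cos as cos * (cos * sec) makes the bracket a multiple of cos^2 +
    sin^2.\<close>
  also have "fps_cos 1 + fps_sin 1 * (fps_sin 1 * (fps_sec 1 :: 'a fps)) =
      fps_cos 1 * (fps_cos 1 * fps_sec 1) + fps_sin 1 * (fps_sin 1 * (fps_sec 1 :: 'a fps))"
    by (simp add: fps_cos_mult_sec)
  also have "\<dots> = ((fps_cos 1)\<^sup>2 + (fps_sin 1)\<^sup>2) * (fps_sec 1 :: 'a fps)"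
    by (simp add: algebra_simps power2_eq_square)
  finally show ?thesis
    unfolding fps_sin_cos_sum_of_squares by (simp add: power2_eq_square)
qed

lemma fps_sec_nth_0: "fps_sec 1 $ 0 = (1 :: 'a::field_char_0)"
  using arg_cong[OF fps_cos_mult_sec, of "\<lambda>f. f $ 0"] by simp

lemma fps_sec_nth_odd: "odd n \<Longrightarrow> fps_sec 1 $ n = (0 :: 'a::field_char_0)"
proof (rule fps_parity_of_even_factor[of "fps_cos 1" False])
  show "(fps_cos 1 * fps_sec 1) $ n = (0 :: 'a)" if "even n = False" for n
    using that by (cases n) (simp_all add: fps_cos_mult_sec)
qed (auto simp: fps_cos_def)

lemma fps_tan_nth_even: "even n \<Longrightarrow> fps_tan 1 $ n = (0 :: 'a::field_char_0)"
proof (rule fps_parity_of_even_factor[of "fps_cos 1" True])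
  have "fps_cos 1 * fps_tan 1 = fps_sin 1 * (fps_cos 1 * (fps_sec 1 :: 'a fps))"
    by (simp add: fps_tan_eq_sin_mult_sec mult_ac)
  then show "(fps_cos 1 * fps_tan 1) $ n = (0 :: 'a)" if "even n = True" for n
    using that by (simp add: fps_cos_mult_sec fps_sin_def)
qed (auto simp: fps_cos_def)

text \<open>The arguments are the predecessor, the letter itself, and the successor in its cycle.\<close>

definition letter_weight :: "'a::linorder \<Rightarrow> 'a \<Rightarrow> 'a \<Rightarrow> real fps" where
  "letter_weight x i y =
    (if x = i then fps_tan 1
     else if x < i then (if i < y then fps_tan 1 + 1 else (fps_sec 1)\<^sup>2)
     else (if i < y then 1 else fps_tan 1 - 1))"

definition perm_weight :: "'a::linorder set \<Rightarrow> ('a \<Rightarrow> 'a) \<Rightarrow> real fps" where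
  "perm_weight S \<pi> = (\<Prod>i\<in>S. letter_weight (inv \<pi> i) i (\<pi> i))"

section \<open>Inserting a new maximum\<close>

context
  fixes S :: "'a::linorder set" and m :: 'a and \<pi> :: "'a \<Rightarrow> 'a"
  assumes fin: "finite S" and max: "\<And>i. i \<in> S \<Longrightarrow> i < m" and perm: "\<pi> permutes S"
begin

lemma perm_weight_new_fixpoint:
  "perm_weight (insert m S) (transpose m m \<circ> \<pi>) = fps_tan 1 * perm_weight S \<pi>"
proof -
  have "m \<notin> S"
    using max by blast
  then have "\<pi> m = m" "inv \<pi> m = m"
    using permutes_not_in[OF perm] permutes_not_in[OF permutes_inv[OF perm]] by auto
  with \<open>m \<notin> S\<close> show ?thesis
    using fin by (simp add: perm_weight_def letter_weight_def)
qed

text \<open>The composition with \<open>transpose m b\<close> splices \<open>m\<close> into the arc,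
  giving a -> m -> b. The smaller endpoint already faced a larger letter there, so its type
  survives; for the larger endpoint that comparison flips. The conditional lists its new weight:
  valley or double descent if a < b, valley if a = b, double ascent or valley if a > b.\<close>

lemma perm_weight_insert:
  assumes b: "b \<in> S"
  defines "a \<equiv> inv \<pi> b"
  shows "perm_weight (insert m S) (transpose m b \<circ> \<pi>) =
    (fps_sec 1)\<^sup>2 *
    (if a < b then (if b < \<pi> b then 1 else fps_tan 1 - 1)
     else if a = b then 1
     else (if inv \<pi> a < a then fps_tan 1 + 1 else 1)) *
    (\<Prod>i\<in>S - {max a b}. letter_weight (inv \<pi> i) i (\<pi> i))"
proof -
  let ?\<sigma> = "transpose m b \<circ> \<pi>"
  let ?w = "\<lambda>i. letter_weight (inv \<pi> i) i (\<pi> i)"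
  let ?w' = "\<lambda>i. letter_weight (inv ?\<sigma> i) i (?\<sigma> i)"
  have bij: "bij \<pi>"
    using perm by (rule permutes_bij)
  have inv_\<sigma>: "inv ?\<sigma> i = inv \<pi> (transpose m b i)" for i
    using bij by (simp add: o_inv_distrib)
  have m: "m \<notin> S"
    using max by blast
  then have fix_m: "\<pi> m = m" "inv \<pi> m = m"
    using permutes_not_in[OF perm] permutes_not_in[OF permutes_inv[OF perm]] by auto
  have a: "a \<in> S" "\<pi> a = b"
    using b perm bij by (auto simp: a_def permutes_in_image[OF permutes_inv] permutes_inverses)
  have less_m: "a < m" "b < m"
    using a b max by auto
  have inv_eq: "inv \<pi> i = j \<longleftrightarrow> \<pi> j = i" for i j
    using bij by (metis bij_inv_eq_iff)
  have S: "i \<in> S \<Longrightarrow> \<pi> i \<in> S" for i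
    using perm by (simp add: permutes_in_image)
  have new: "?w' m = (fps_sec 1)\<^sup>2"
    using less_m m fix_m by (auto simp: inv_\<sigma> a_def[symmetric] letter_weight_def)
  have same: "?w' i = ?w i" if i: "i \<in> S - {max a b}" for i
  proof -
    consider "i \<noteq> a" "i \<noteq> b" | "i = a" "a < b" | "i = b" "b < a"
      using i by (cases a b rule: linorder_cases) auto
    then show ?thesis
    proof cases
      \<comment> \<open>Only \<open>a\<close> is mapped to \<open>b\<close>, so neither neighbour of
        \<open>i\<close> changes.\<close>
      case 1
      then have "i \<noteq> m" "\<pi> i \<noteq> m" "\<pi> i \<noteq> b"
        using i m S[of i] inv_eq[of b i] a_def by auto
      with 1 show ?thesis
        by (simp add: inv_\<sigma> transpose_def)
    next
      case 2
      then show ?thesis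
        using less_m a fix_m inv_eq by (auto simp: inv_\<sigma> transpose_def letter_weight_def)
    next
      case 3
      then have "\<pi> b \<noteq> b" "\<pi> b \<noteq> m"
        using a b S m inv_eq[of b b] a_def by auto
      with 3 show ?thesis
        using less_m m fix_m by (auto simp: inv_\<sigma> transpose_def letter_weight_def a_def[symmetric])
    qed
  qed
  have changed: "?w' (max a b) =
    (if a < b then (if b < \<pi> b then 1 else fps_tan 1 - 1)
     else if a = b then 1
     else (if inv \<pi> a < a then fps_tan 1 + 1 else 1))"
  proof (cases a b rule: linorder_cases)
    case less
    then have "\<pi> b \<noteq> b" "\<pi> b \<noteq> m"
      using a b S m inv_eq[of b b] a_def by auto
    with less show ?thesis
      using less_m m fix_m by (auto simp: inv_\<sigma> transpose_def letter_weight_def max_def)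
  next
    case equal
    then show ?thesis
      using less_m a m fix_m by (auto simp: inv_\<sigma> transpose_def letter_weight_def)
  next
    case greater
    then have "inv \<pi> a \<noteq> a"
      using a inv_eq by auto
    with greater show ?thesis
      using less_m a m fix_m by (auto simp: inv_\<sigma> transpose_def letter_weight_def max_def)
  qed
  have "max a b \<in> S"
    using a b by (simp add: max_def)
  then have "perm_weight (insert m S) ?\<sigma> = ?w' m * (?w' (max a b) * (\<Prod>i\<in>S - {max a b}. ?w' i))"
    using fin m by (simp add: perm_weight_def prod.remove del: o_apply)
  also have "(\<Prod>i\<in>S - {max a b}. ?w' i) = (\<Prod>i\<in>S - {max a b}. ?w i)"
    using same by (rule prod.cong[OF refl])
  finally show ?thesis
    unfolding new changed by (simp only: mult.assoc)
qed

text \<open>Each arc is charged to the letter whose type it changes. A peak is charged twice, by its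
  incoming and its outgoing arc, giving the summands tan - 1 and tan + 1 of its derivative. Double
  ascents, double descents and fixed points are charged once, valleys never, matching their constant
  weight.\<close>

lemma sum_perm_weight_insert:
  "(\<Sum>b\<in>S. perm_weight (insert m S) (transpose m b \<circ> \<pi>)) = fps_deriv (perm_weight S \<pi>)"
proof -
  let ?w = "\<lambda>i. letter_weight (inv \<pi> i) i (\<pi> i)"
  let ?R = "\<lambda>i. \<Prod>j\<in>S - {i}. ?w j"
  let ?s = "(fps_sec 1 :: real fps)\<^sup>2"
  \<comment> \<open>Ascending arcs are charged to their head, loops to their fixed point, descending
    arcs to their tail.\<close>
  let ?up = "\<lambda>b. if inv \<pi> b < b then ?s * (if b < \<pi> b then 1 else fps_tan 1 - 1) * ?R b else 0"
  let ?fix = "\<lambda>b. if inv \<pi> b = b then ?s * ?R b else 0"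
  let ?down = "\<lambda>a. if \<pi> a < a then ?s * (if inv \<pi> a < a then fps_tan 1 + 1 else 1) * ?R a else 0"
  have bij: "bij \<pi>"
    using perm by (rule permutes_bij)
  have inv_eq: "inv \<pi> i = j \<longleftrightarrow> \<pi> j = i" for i j
    using bij by (metis bij_inv_eq_iff)
  have pi_inv: "\<pi> (inv \<pi> i) = i" for i
    using inv_eq by blast
  have "(\<Sum>b\<in>S. perm_weight (insert m S) (transpose m b \<circ> \<pi>)) =
      (\<Sum>b\<in>S. ?up b + ?fix b + ?down (inv \<pi> b))"
    by (intro sum.cong refl) (auto simp: perm_weight_insert pi_inv max_def)
  also have "\<dots> = (\<Sum>b\<in>S. ?up b) + (\<Sum>b\<in>S. ?fix b) + (\<Sum>b\<in>S. ?down (inv \<pi> b))"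
    by (simp only: sum.distrib)
  \<comment> \<open>Reindexing from the head of an arc to its tail.\<close>
  also have "(\<Sum>b\<in>S. ?down (inv \<pi> b)) = (\<Sum>a\<in>S. ?down a)"
    using sum.permute[OF permutes_inv[OF perm], of ?down] by (simp add: o_def)
  also have "(\<Sum>b\<in>S. ?up b) + (\<Sum>b\<in>S. ?fix b) + (\<Sum>a\<in>S. ?down a) =
      (\<Sum>i\<in>S. ?up i + ?fix i + ?down i)"
    by (simp only: sum.distrib)
  also have "\<dots> = (\<Sum>i\<in>S. fps_deriv (?w i) * ?R i)"
  proof (intro sum.cong refl)
    fix i assume "i \<in> S"
    have "inv \<pi> i = i \<longleftrightarrow> \<pi> i = i"
      using inv_eq by blast
    then show "?up i + ?fix i + ?down i = fps_deriv (?w i) * ?R i"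
      by (cases "inv \<pi> i" i rule: linorder_cases; cases "\<pi> i" i rule: linorder_cases)
        (auto simp: letter_weight_def fps_deriv_tan fps_deriv_sec power2_eq_square algebra_simps)
  qed
  also have "\<dots> = fps_deriv (perm_weight S \<pi>)"
    unfolding perm_weight_def using fin by (simp add: fps_deriv_prod)
  finally show ?thesis .
qed

end

text \<open>Induction by adding a maximum: if W is the total weight, then (sec * W)' = sec * (tan *
  W + W'), whose two terms come from the new letter being fixed and being spliced into an
  arc.\<close>

lemma higher_deriv_sec_eq_sum_perm_weight:
  fixes S :: "'a::linorder set"
  assumes "finite S"
  shows "(fps_deriv ^^ card S) (fps_sec 1) = fps_sec 1 * (\<Sum>\<pi> | \<pi> permutes S. perm_weight S \<pi>)"
  using assms
proof (induction S rule: finite_linorder_max_induct)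
  case empty
  then show ?case
    by (simp add: perm_weight_def)
next
  case (insert m S)
  then have m: "m \<notin> S"
    by blast
  let ?P = "{\<pi>. \<pi> permutes S}"
  \<comment> \<open>Here \<open>b\<close> is the image of \<open>m\<close>; the choice b = m makes
    \<open>m\<close> a fixed point.\<close>
  have "(\<Sum>\<pi> | \<pi> permutes insert m S. perm_weight (insert m S) \<pi>) =
      (\<Sum>b\<in>insert m S. \<Sum>\<pi>\<in>?P. perm_weight (insert m S) (transpose m b \<circ> \<pi>))"
    using insert m by (intro sum_over_permutations_insert) auto
  also have "\<dots> = (\<Sum>\<pi>\<in>?P. \<Sum>b\<in>insert m S. perm_weight (insert m S) (transpose m b \<circ> \<pi>))"
    by (rule sum.swap)
  also have "\<dots> = (\<Sum>\<pi>\<in>?P. fps_tan 1 * perm_weight S \<pi> + fps_deriv (perm_weight S \<pi>))"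
  proof (intro sum.cong refl)
    fix \<pi> assume "\<pi> \<in> ?P"
    then show "(\<Sum>b\<in>insert m S. perm_weight (insert m S) (transpose m b \<circ> \<pi>)) =
        fps_tan 1 * perm_weight S \<pi> + fps_deriv (perm_weight S \<pi>)"
      using insert m sum_perm_weight_insert[of S m \<pi>] perm_weight_new_fixpoint[of S m \<pi>]
      by simp
  qed
  also have "\<dots> = fps_tan 1 * (\<Sum>\<pi>\<in>?P. perm_weight S \<pi>) + fps_deriv (\<Sum>\<pi>\<in>?P. perm_weight S \<pi>)"
    by (simp add: sum.distrib sum_distrib_left fps_deriv_sum)
  finally show ?case
    using insert m by (simp add: fps_deriv_sec algebra_simps)
qed

section \<open>Constant terms and signed derangements\<close>

lemma fps_prod_nth_0: "(prod f A) $ 0 = (\<Prod>i\<in>A. f i $ 0 :: 'a::comm_ring_1)"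
  by (induction A rule: infinite_finite_induct) auto

text \<open>\<open>cddes\<close> indexes a double descent by the predecessor i, the weights by the
  letter j = \<pi> i itself; \<pi> translates between the two.\<close>

lemma cddes_eq_card_letters:
  assumes "\<pi> permutes {1..n}"
  shows "cddes n \<pi> = card {j \<in> {1..n}. j < inv \<pi> j \<and> \<pi> j < j}"
proof -
  have "bij_betw \<pi> {i \<in> {1..n}. i > \<pi> i \<and> \<pi> i > \<pi> (\<pi> i)}
      {j \<in> {1..n}. j < inv \<pi> j \<and> \<pi> j < j}"
    using assms
    by (intro bij_betw_byWitness[where f' = "inv \<pi>"])
      (auto simp: permutes_inverses simp del: atLeastAtMost_iff
        simp: permutes_in_image permutes_in_image[OF permutes_inv])
  then show ?thesis
    unfolding cddes_def by (rule bij_betw_same_card)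
qed

lemma perm_weight_nth_0:
  assumes perm: "\<pi> permutes {1..n}"
  shows "perm_weight {1..n} \<pi> $ 0 = (if \<pi> \<in> derangements n then (-1) ^ cddes n \<pi> else 0)"
proof -
  have inv_eq: "inv \<pi> i = i \<longleftrightarrow> \<pi> i = i" for i
    using permutes_inverses[OF perm] by metis
  have tan0: "fps_tan 1 $ 0 = (0 :: real)"
    by (rule fps_tan_nth_even) simp
  have w: "letter_weight (inv \<pi> i) i (\<pi> i) $ 0 =
      (if \<pi> i = i then 0 else if i < inv \<pi> i \<and> \<pi> i < i then -1 else 1)" for i
    using inv_eq[of i] by (auto simp: letter_weight_def fps_sec_nth_0 tan0 power2_eq_square)
  show ?thesis
  proof (cases "\<pi> \<in> derangements n")
    case True
    then have "perm_weight {1..n} \<pi> $ 0 = (\<Prod>i\<in>{1..n}. if i < inv \<pi> i \<and> \<pi> i < i then -1 else 1)"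
      unfolding perm_weight_def fps_prod_nth_0 w
      by (intro prod.cong) (auto simp: derangements_def)
    also have "\<dots> = (-1) ^ cddes n \<pi>"
      by (simp add: prod.If_cases cddes_eq_card_letters[OF perm] Int_def)
    finally show ?thesis
      using True by simp
  next
    case False
    then obtain i where "i \<in> {1..n}" "\<pi> i = i"
      using perm by (auto simp: derangements_def)
    then have "perm_weight {1..n} \<pi> $ 0 = 0"
      unfolding perm_weight_def fps_prod_nth_0 w by (intro prod_zero bexI[of _ i]) simp_all
    then show ?thesis
      using False by simp
  qed
qed

lemma D_cddes_minus_one: "D_cddes n (-1) = fact n * fps_sec 1 $ n"
proof -
  let ?P = "{\<pi>. \<pi> permutes {1..n}}"
  have fin: "finite ?P"
    by (simp add: finite_permutations)
  \<comment> \<open>Writing n as \<open>card {1..n}\<close> brings the derivative into the form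
    treated above.\<close>
  have "fact n * fps_sec 1 $ n = (fps_deriv ^^ card {1..n}) (fps_sec 1 :: real fps) $ 0"
    by (simp add: fps_0th_higher_deriv)
  also have "\<dots> = (\<Sum>\<pi>\<in>?P. perm_weight {1..n} \<pi> $ 0)"
    unfolding higher_deriv_sec_eq_sum_perm_weight[OF finite_atLeastAtMost]
    by (simp add: fps_sec_nth_0 fps_sum_nth)
  also have "\<dots> = (\<Sum>\<pi>\<in>?P. if \<pi> \<in> derangements n then (-1) ^ cddes n \<pi> else 0)"
    by (intro sum.cong refl perm_weight_nth_0) simp
  also have "\<dots> = (\<Sum>\<pi>\<in>?P \<inter> derangements n. (-1) ^ cddes n \<pi>)"
    using fin by (simp add: sum.inter_restrict)
  also have "?P \<inter> derangements n = derangements n"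
    by (auto simp: derangements_def)
  finally show ?thesis
    by (simp add: D_cddes_def)
qed

theorem theorem16:
  shows "(\<forall>n\<ge>1. D_cddes n (-1) = (if even n then euler_number n else 0)) \<and>
    D_cddes_egf (-1) = fps_sec 1"
proof
  \<comment> \<open>In even degree only sec contributes to the Euler number; in odd degree the
    coefficient of sec is zero.\<close>
  show "\<forall>n\<ge>1. D_cddes n (-1) = (if even n then euler_number n else 0)"
    by (simp add: D_cddes_minus_one euler_number_def fps_tan_nth_even fps_sec_nth_odd)
  show "D_cddes_egf (-1) = fps_sec 1"
    by (rule fps_ext) (simp add: D_cddes_egf_def D_cddes_minus_one fps_sec_nth_0)
qed

end
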